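(* Let $z_n^i=[u_n^i,\phi_n^i,w_n^i,v_n^i]^\top$, $N$-periodic in $n$, satisfy the Preissmann box scheme for the Benjamin equation $$M\delta_t^+ z_{n+1/2}^i+K\delta_x^+ z_n^{i+1/2}=\frac{\delta\mathcal S}{\delta z}(z_{n+1/2}^{i+1/2}),\qquad \frac{\delta\mathcal S}{\delta z}(z_{n+1/2}^{i+1/2})=\begin{bmatrix}-w_{n+1/2}^{i+1/2}-\gamma u_{n+1/2}^{i+1/2}-\frac{\lambda}{2}(u_{n+1/2}^{i+1/2})^2+\alpha (L_{\Delta x}\boldsymbol u^{i+1/2})_{n+1/2}\\ 0\\ -u_{n+1/2}^{i+1/2}\\ \beta v_{n+1/2}^{i+1/2}\end{bmatrix}.$$ Define the two-forms $$\omega_{n+1/2}^i=\tfrac12\, \mathrm d z_{n+1/2}^{i}\wedge M\,\mathrm d z_{n+1/2}^i,\qquad \kappa_n^{i+1/2}=\tfrac12\,\mathrm d z_{n}^{i+1/2}\wedge K\,\mathrm d z_n^{i+1/2} .$$ Then $$\delta_t^+\omega_{n+1/2}^i+\delta_x^+\kappa_n^{i+1/2}=\alpha\,\mathrm d u_{n+1/2}^{i+1/2}\wedge (L_{\Delta x}\,\mathrm d\boldsymbol u^{i+1/2})_{n+1/2}$$ and $$\delta_t^+\sum_{n=0}^{N-1}\omega_{n+1/2}^i=0 .$$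
   Context: Real parameters $\alpha,\beta,\gamma,\lambda$; period $l>0$; number of grid points $N$; $\Delta x=l/N$; time step $\Delta t>0$; $u_n^i\approx u(i\Delta t,n\Delta x)$. The periodic boundary condition is imposed: all grid functions are $N$-periodic in $n$. $X_{\mathrm d}$ is the space of sequences $\boldsymbol u=\{u_n\}_{n\in\mathbb Z}$ with $u_{n+N}=u_n$; $\boldsymbol u^i=\{u_n^i\}_{n\in\mathbb Z}\in X_{\mathrm d}$. Averages and differences: $u_{n+1/2}=(u_n+u_{n+1})/2$, $u^{i+1/2}=(u^i+u^{i+1})/2$ (both averages are applied when both indices are half-integers; likewise $(L_{\Delta x}\boldsymbol u)_{n+1/2}=((L_{\Delta x}\boldsymbol u)_n+(L_{\Delta x}\boldsymbol u)_{n+1})/2$); $\delta_x^+u_n=(u_{n+1}-u_n)/\Delta x$, $\delta_t^+u^i=(u^{i+1}-u^i)/\Delta t$. Matrices: $$M=\begin{bmatrix}0&\frac12&0&0\\-\frac12&0&0&0\\0&0&0&0\\0&0&0&0\end{bmatrix},\qquad K=\begin{bmatrix}0&0&0&-\beta\\0&0&1&0\\0&-1&0&0\\ \beta&0&0&0\end{bmatrix}.$$ Discrete Fourier transform: $(F_{\Delta x}\boldsymbol u)_k=\sum_{n=0}^{N-1}u_n\mathrm e^{-2\pi \mathrm i nk/N}$, with inverse $(F_{\Delta x}^{-1}\boldsymbol v)_n=\frac1N\sum_{k=0}^{N-1}v_k\mathrm e^{2\pi \mathrm i nk/N}$. The operator $L_{\Delta x}$ (discretization of $L=H\partial_x$,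 $H$ the Hilbert transform) is $L_{\Delta x}\boldsymbol u=F_{\Delta x}^{-1}\left(\frac{2\pi}{l}\tilde K S\right)F_{\Delta x}\boldsymbol u$, where the diagonal matrices act on the components $k=0,\dots,N-1$ and - if $N$ is even: $\tilde K=\mathrm{diag}(0,1,\dots,\frac N2-1,0,-(\frac N2-1),\dots,-1)$ and $S=\mathrm{diag}(0,1,\dots,1,0,-1,\dots,-1)$ with $\frac N2-1$ entries $1$ and $\frac N2-1$ entries $-1$; - if $N$ is odd: $\tilde K=\mathrm{diag}(0,1,\dots,\frac{N-1}2,-\frac{N-1}2,\dots,-1)$ and $S=\mathrm{diag}(0,1,\dots,1,-1,\dots,-1)$ with $\frac{N-1}2$ entries $1$ and $\frac{N-1}2$ entries $-1$. Differentials: $\mathrm d z_n^i$ denotes the vector of differential one-forms of $z_n^i$ (differentiating with respect to the parameters/initial data of a smooth family of numerical solutions, $N$-periodic in $n$); these satisfy the discrete variational equation $M\delta_t^+\,\mathrm dz_{n+1/2}^i+K\delta_x^+\,\mathrm dz_n^{i+1/2}=\mathrm d\left(\frac{\delta\mathcal S}{\delta z}(z_{n+1/2}^{i+1/2})\right)$. Real matrices act linearly on vectors of one-forms, $L_{\Delta x}\,\mathrm d\boldsymbol u$ is $L_{\Delta x}$ applied to $\{\mathrm d u_n\}_n$, and for vectors of one-forms $a\wedge b=\sum_k a_k\wedge b_k$. *)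

theory Defs
  imports "HOL-Analysis.Analysis"
begin

text \<open>A grid function has a time index (first argument) and a space index (second argument);
  the value at \<open>n + 1/2\<close> or \<open>i + 1/2\<close> is stored at index \<open>n\<close> or \<open>i\<close>. The operators below
  are used for real values, for vectors, and for differential forms alike.\<close>

type_synonym 'a grid = "nat \<Rightarrow> int \<Rightarrow> 'a"

definition mean_x :: "'a::real_vector grid \<Rightarrow> 'a grid" where
  "mean_x f i n = (1/2) *\<^sub>R (f i n + f i (n + 1))"

definition mean_t :: "'a::real_vector grid \<Rightarrow> 'a grid" where
  "mean_t f i n = (1/2) *\<^sub>R (f i n + f (i + 1) n)"

definition diff_x :: "real \<Rightarrow> 'a::real_vector grid \<Rightarrow> 'a grid" where
  "diff_x dx f i n = (1/dx) *\<^sub>R (f i (n + 1) - f i n)"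

definition diff_t :: "real \<Rightarrow> 'a::real_vector grid \<Rightarrow> 'a grid" where
  "diff_t dt f i n = (1/dt) *\<^sub>R (f (i + 1) n - f i n)"


subsection \<open>The discretized operator \<open>L = H \<partial>\<^sub>x\<close>\<close>

definition dft :: "nat \<Rightarrow> (int \<Rightarrow> complex) \<Rightarrow> nat \<Rightarrow> complex" where
  "dft N u k = (\<Sum>n<N. u (int n) * exp (- (2 * pi * \<i> * of_nat n * of_nat k / of_nat N)))"

definition idft :: "nat \<Rightarrow> (nat \<Rightarrow> complex) \<Rightarrow> int \<Rightarrow> complex" where
  "idft N v n = (1 / of_nat N) * (\<Sum>k<N. v k * exp (2 * pi * \<i> * of_int n * of_nat k / of_nat N))"

definition Kdiag :: "nat \<Rightarrow> nat \<Rightarrow> real" where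
  "Kdiag N k =
    (if even N then
       (if k < N div 2 then real k else if k = N div 2 then 0 else real k - real N)
     else (if k \<le> (N - 1) div 2 then real k else real k - real N))"

definition Sdiag :: "nat \<Rightarrow> nat \<Rightarrow> real" where
  "Sdiag N k =
    (if k = 0 then 0
     else if even N then (if k < N div 2 then 1 else if k = N div 2 then 0 else -1)
     else (if k \<le> (N - 1) div 2 then 1 else -1))"

definition L_complex :: "real \<Rightarrow> nat \<Rightarrow> (int \<Rightarrow> complex) \<Rightarrow> int \<Rightarrow> complex" where
  "L_complex l N u =
     idft N (\<lambda>k. complex_of_real (2 * pi / l * Kdiag N k * Sdiag N k) * dft N u k)"

text \<open>On real sequences the operator is real-valued (lemma \<open>L_complex_of_real\<close> below), so
  taking the real part only changes the type.\<close>

definition L_real :: "real \<Rightarrow> nat \<Rightarrow> (int \<Rightarrow> real) \<Rightarrow> int \<Rightarrow> real" where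
  "L_real l N u n = Re (L_complex l N (\<lambda>m. complex_of_real (u m)) n)"

lemma Kdiag_Sdiag_reflect:
  assumes "0 < k" "k < N"
  shows "Kdiag N (N - k) * Sdiag N (N - k) = Kdiag N k * Sdiag N k"
proof (cases "even N")
  case True
  then obtain m where m: "N = 2 * m" by (auto elim: evenE)
  consider "k < m" | "k = m" | "k > m" by linarith
  then show ?thesis
    using assms unfolding m by cases (auto simp: Kdiag_def Sdiag_def of_nat_diff)
next
  case False
  then obtain m where m: "N = 2 * m + 1" by (auto elim: oddE)
  consider "k \<le> m" | "k > m" by linarith
  then show ?thesis
    using assms unfolding m by cases (simp_all add: Kdiag_def Sdiag_def of_nat_diff)
qed

lemma exp_reflect:
  fixes j :: int
  assumes "0 < k" "k < N"
  shows "exp (2 * pi * \<i> * of_int j * of_nat (N - k) / of_nat N)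
       = cnj (exp (2 * pi * \<i> * of_int j * of_nat k / of_nat N))"
proof -
  have "2 * pi * \<i> * of_int j * of_nat (N - k) / of_nat N
      = 2 * of_int j * pi * \<i> - 2 * pi * \<i> * of_int j * of_nat k / of_nat N"
    using assms by (simp add: of_nat_diff field_simps)
  moreover have "exp (2 * of_int j * complex_of_real pi * \<i>) = 1"
    using exp_integer_2pi[of "of_int j"] by (simp add: mult_ac)
  ultimately show ?thesis
    by (simp add: exp_diff exp_cnj exp_minus divide_inverse)
qed

lemma L_complex_of_real:
  "L_complex l N (\<lambda>m. complex_of_real (u m)) n = complex_of_real (L_real l N u n)"
proof -
  define e where "e j k = exp (2 * pi * \<i> * of_int j * of_nat k / of_nat N)" for j :: int and k :: nat
  define t where "t k = complex_of_real (2 * pi / l * Kdiag N k * Sdiag N k) *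
      (\<Sum>m<N. complex_of_real (u (int m)) * e (- int m) k) * e n k" for k
  have L: "L_complex l N (\<lambda>m. complex_of_real (u m)) n = (1 / of_nat N) * (\<Sum>k<N. t k)"
    by (simp add: L_complex_def idft_def dft_def t_def e_def)
  have t0: "t 0 = 0" by (simp add: t_def Sdiag_def)
  have tr: "t (N - k) = cnj (t k)" if "0 < k" "k < N" for k
  proof -
    have er: "e j (N - k) = cnj (e j k)" for j
      unfolding e_def by (rule exp_reflect[OF that])
    have "2 * pi / l * Kdiag N (N - k) * Sdiag N (N - k) = 2 * pi / l * Kdiag N k * Sdiag N k"
      using Kdiag_Sdiag_reflect[OF that] by (simp add: mult.assoc)
    then show ?thesis
      unfolding t_def er by (auto simp del: of_real_mult)
  qed
  have s: "(\<Sum>k<N. t k) = (\<Sum>k\<in>{1..<N}. t k)"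
    by (rule sum.mono_neutral_right) (auto simp: t0 not_less_eq_eq)
  have "(\<Sum>k\<in>{1..<N}. t k) = (\<Sum>k\<in>{1..<N}. t (N - k))"
    by (rule sum.reindex_bij_witness[of _ "\<lambda>k. N - k" "\<lambda>k. N - k"]) auto
  also have "\<dots> = cnj (\<Sum>k\<in>{1..<N}. t k)"
    by (simp add: tr)
  finally have "(\<Sum>k<N. t k) \<in> \<real>"
    unfolding s by (metis Reals_cnj_iff)
  then have "L_complex l N (\<lambda>m. complex_of_real (u m)) n \<in> \<real>"
    unfolding L by (intro Reals_mult Reals_divide) auto
  then show ?thesis by (simp add: L_real_def)
qed


subsection \<open>Differential forms on the parameter space at a fixed parameter\<close>

text \<open>The parameters of a family of solutions range over a normed space \<open>'p\<close>. At a given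
  parameter, a one-form is a bounded linear functional on \<open>'p\<close>, and a two-form is a bounded
  bilinear form on \<open>'p\<close>.\<close>

type_synonym 'p form1 = "'p \<Rightarrow>\<^sub>L real"
type_synonym 'p form2 = "'p \<Rightarrow>\<^sub>L 'p \<Rightarrow>\<^sub>L real"

definition d :: "('p::real_normed_vector \<Rightarrow> real) \<Rightarrow> 'p \<Rightarrow> 'p form1" where
  "d f p = Blinfun (frechet_derivative f (at p))"

lemma d_apply:
  assumes "(f has_derivative f') (at p)"
  shows "blinfun_apply (d f p) = f'"
  using assms frechet_derivative_at[OF assms] has_derivative_bounded_linear[OF assms]
  by (simp add: d_def bounded_linear_Blinfun_apply)

definition d_vec :: "('p::real_normed_vector \<Rightarrow> real^4) \<Rightarrow> 'p \<Rightarrow> 'p form1^4" where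
  "d_vec f p = (\<chi> k. d (\<lambda>q. f q $ k) p)"

definition d_grid :: "(nat \<Rightarrow> int \<Rightarrow> 'p::real_normed_vector \<Rightarrow> real^4) \<Rightarrow> 'p \<Rightarrow> ('p form1^4) grid" where
  "d_grid z p i n = d_vec (z i n) p"

definition wedge :: "'p::real_normed_vector form1 \<Rightarrow> 'p form1 \<Rightarrow> 'p form2" where
  "wedge a b = (blinfun_scaleR_left b o\<^sub>L a) - (blinfun_scaleR_left a o\<^sub>L b)"

lemma wedge_apply:
  "blinfun_apply (blinfun_apply (wedge a b) \<xi>) \<eta>
     = blinfun_apply a \<xi> * blinfun_apply b \<eta> - blinfun_apply b \<xi> * blinfun_apply a \<eta>"
  by (simp add: wedge_def blinfun.diff_left blinfun.scaleR_left)

definition wedge_vec :: "'p::real_normed_vector form1^4 \<Rightarrow> 'p form1^4 \<Rightarrow> 'p form2" where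
  "wedge_vec a b = (\<Sum>k\<in>UNIV. wedge (a $ k) (b $ k))"

definition matrix_form_mult :: "real^4^4 \<Rightarrow> 'p::real_normed_vector form1^4 \<Rightarrow> 'p form1^4" where
  "matrix_form_mult A a = (\<chi> j. \<Sum>k\<in>UNIV. (A $ j $ k) *\<^sub>R (a $ k))"

text \<open>The operator on sequences of one-forms acts pointwise in the tangent vector.\<close>

definition L_form :: "real \<Rightarrow> nat \<Rightarrow> (int \<Rightarrow> 'p::real_normed_vector form1) \<Rightarrow> int \<Rightarrow> 'p form1" where
  "L_form l N a n = Blinfun (\<lambda>\<xi>. L_real l N (\<lambda>m. blinfun_apply (a m) \<xi>) n)"

lemma L_form_apply:
  "blinfun_apply (L_form l N a n) \<xi> = L_real l N (\<lambda>m. blinfun_apply (a m) \<xi>) n"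
proof -
  have "bounded_linear (\<lambda>\<xi>. L_real l N (\<lambda>m. blinfun_apply (a m) \<xi>) n)"
    unfolding L_real_def L_complex_def idft_def dft_def
    by (intro bounded_linear_compose[OF bounded_linear_Re] bounded_linear_sum
        bounded_linear_const_mult bounded_linear_mult_const
        bounded_linear_compose[OF bounded_linear_of_real] blinfun.bounded_linear_right)
  then show ?thesis
    by (simp add: L_form_def bounded_linear_Blinfun_apply)
qed


subsection \<open>The Preissmann box scheme for the Benjamin equation\<close>

text \<open>The state vector is \<open>z = [u, \<phi>, w, v]\<close>, with components \<open>z $ 1\<close>, \<dots>, \<open>z $ 4\<close>.\<close>

definition Mmat :: "real^4^4" where
  "Mmat = vector [vector [0, 1/2, 0, 0],
                  vector [-1/2, 0, 0, 0],
                  vector [0, 0, 0, 0],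
                  vector [0, 0, 0, 0]]"

definition Kmat :: "real \<Rightarrow> real^4^4" where
  "Kmat \<beta> = vector [vector [0, 0, 0, -\<beta>],
                    vector [0, 0, 1, 0],
                    vector [0, -1, 0, 0],
                    vector [\<beta>, 0, 0, 0]]"

text \<open>The variational derivative evaluated at \<open>(n + 1/2, i + 1/2)\<close>.\<close>

definition grad_S :: "real \<Rightarrow> real \<Rightarrow> real \<Rightarrow> real \<Rightarrow> real \<Rightarrow> nat \<Rightarrow> (real^4) grid \<Rightarrow> (real^4) grid" where
  "grad_S \<alpha> \<beta> \<gamma> lam l N z i n =
    (let u = (\<lambda>i n. z i n $ 1);
         zc = mean_t (mean_x z) i n;
         Lu = mean_x (\<lambda>i. L_real l N (mean_t u i)) i n
     in vector [- zc $ 3 - \<gamma> * zc $ 1 - lam / 2 * (zc $ 1)^2 + \<alpha> * Lu,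
                0,
                - zc $ 1,
                \<beta> * zc $ 4])"

definition box_scheme ::
  "real \<Rightarrow> real \<Rightarrow> real \<Rightarrow> real \<Rightarrow> real \<Rightarrow> nat \<Rightarrow> real \<Rightarrow> real \<Rightarrow> (real^4) grid \<Rightarrow> bool" where
  "box_scheme \<alpha> \<beta> \<gamma> lam l N dx dt z \<longleftrightarrow>
    (\<forall>i n. Mmat *v diff_t dt (mean_x z) i n + Kmat \<beta> *v diff_x dx (mean_t z) i n
             = grad_S \<alpha> \<beta> \<gamma> lam l N z i n)"

definition \<omega> :: "('p::real_normed_vector form1^4) grid \<Rightarrow> 'p form2 grid" where
  "\<omega> dz i n = (1/2) *\<^sub>R wedge_vec (mean_x dz i n) (matrix_form_mult Mmat (mean_x dz i n))"

definition \<kappa> :: "real \<Rightarrow> ('p::real_normed_vector form1^4) grid \<Rightarrow> 'p form2 grid" where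
  "\<kappa> \<beta> dz i n =
    (1/2) *\<^sub>R wedge_vec (mean_t dz i n) (matrix_form_mult (Kmat \<beta>) (mean_t dz i n))"

end

theory Submission
  imports Defs
begin

text \<open>Write \<open>a\<close> for the vector of one-forms \<open>dz\<close> averaged to the centre of a grid cell. For a
  skew-symmetric matrix \<open>A\<close> the form \<open>b \<wedge> A c\<close> is symmetric in \<open>b\<close> and \<open>c\<close>, so the difference of
  two values of \<open>1/2 b \<wedge> A b\<close> is exactly the mean of the two arguments wedged with \<open>A\<close> applied to
  their difference (\<open>skew_quadratic_difference\<close>): no remainder survives from the discrete product
  rule. The averages in time and in space commute, so the time difference of \<open>\<omega>\<close> and
  the space difference of \<open>\<kappa>\<close> both produce the same factor \<open>a\<close>, and the left-hand side of the local law is \<open>a\<close> wedged with the left-hand side of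
  the discrete variational equation (\<open>diff_t_\<omega>\<close>, \<open>diff_x_\<kappa>\<close>, \<open>variational_equation\<close>).

  The right-hand side of the variational equation is a symmetric matrix applied to \<open>a\<close>, plus the
  nonlocal term in the first component. A symmetric matrix contributes nothing to \<open>a \<wedge> S a\<close>, so
  only \<open>\<alpha> du \<wedge> L du\<close> is left: the local law fails to be a conservation law precisely because \<open>L\<close>
  couples different cells.

  Summed over a period, this defect vanishes. The symbol of \<open>L\<close> is real and even in the
  wave number, so \<open>L\<close> is convolution with a real, even, periodic kernel
  (\<open>L_real_convolution\<close>). It is therefore self-adjoint, which kills the sum of \<open>du \<wedge> L du\<close>
  (\<open>sum_wedge_L_form\<close>), and it commutes with translations, so that it may be exchanged with the
  average in \<open>x\<close> (\<open>L_form_midpoint\<close>). The fluxes \<open>\<kappa>\<close> telescope by periodicity, and what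
  remains is conservation of the total of \<open>\<omega>\<close>.\<close>

section \<open>Sums over one period\<close>

lemma sum_period_shift:
  fixes f :: "int \<Rightarrow> 'a::ab_group_add"
  assumes "f (int N) = f 0"
  shows "(\<Sum>n<N. f (int n + 1)) = (\<Sum>n<N. f (int n))"
proof -
  have "(\<Sum>n<N. f (int n + 1) - f (int n)) = f (int N) - f (int 0)"
    using sum_lessThan_telescope[of "\<lambda>n. f (int n)" N] by (simp add: add.commute)
  then show ?thesis
    using assms by (simp add: sum_subtractf)
qed

section \<open>The operator as a convolution\<close>

text \<open>The inverse discrete Fourier transform of the symbol of \<open>L\<close>. Its sine part is dropped: the
  symbol is the same at the wave numbers \<open>k\<close> and \<open>N - k\<close>, so the sine part cancels, and
  \<open>L_real\<close> discards it in any case by taking a real part.\<close>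

definition L_kernel :: "real \<Rightarrow> nat \<Rightarrow> int \<Rightarrow> real" where
  "L_kernel l N j =
    (\<Sum>k<N. (2 * pi / l * Kdiag N k * Sdiag N k) * cos (2 * pi * real_of_int j * real k / real N))
      / real N"

text \<open>Interchanging the two finite sums of the transform and its inverse collects, for each pair of
  grid points, the factor \<open>exp (2 \<pi> \<i> (n - m) k / N)\<close>, which depends on \<open>n - m\<close> only.\<close>

lemma L_real_convolution:
  "L_real l N u n = (\<Sum>m<N. L_kernel l N (n - int m) * u (int m))"
proof -
  define e where "e j k = exp (2 * pi * \<i> * of_int j * of_nat k / of_nat N)" for j :: int and k :: nat
  define \<mu> where "\<mu> k = 2 * pi / l * Kdiag N k * Sdiag N k" for k
  have e_add: "e (- int m) k * e n k = e (n - int m) k" for m k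
    unfolding e_def exp_add[symmetric] by (simp add: field_simps diff_divide_distrib)
  have Re_e: "Re (e j k) = cos (2 * pi * real_of_int j * real k / real N)" for j k
  proof -
    have "2 * pi * \<i> * of_int j * of_nat k / of_nat N
        = \<i> * complex_of_real (2 * pi * real_of_int j * real k / real N)"
      by simp
    then show ?thesis
      unfolding e_def by (simp only: Re_exp) simp
  qed
  have "L_complex l N (\<lambda>m. complex_of_real (u m)) n
      = (1 / of_nat N) * (\<Sum>k<N. (\<Sum>m<N. complex_of_real (\<mu> k * u (int m)) * (e (- int m) k * e n k)))"
    by (simp add: L_complex_def idft_def dft_def e_def \<mu>_def sum_distrib_left sum_distrib_right mult_ac)
  also have "\<dots> = complex_of_real (1 / real N)
      * (\<Sum>k<N. (\<Sum>m<N. complex_of_real (\<mu> k * u (int m)) * e (n - int m) k))"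
    by (simp add: e_add)
  finally have "L_real l N u n
      = (1 / real N) * (\<Sum>k<N. \<Sum>m<N. \<mu> k * u (int m) * Re (e (n - int m) k))"
    unfolding L_real_def by (simp del: of_real_mult of_real_divide)
  also have "\<dots> = (1 / real N) * (\<Sum>m<N. \<Sum>k<N. \<mu> k * u (int m) * Re (e (n - int m) k))"
    by (subst sum.swap) simp
  also have "\<dots> = (\<Sum>m<N. L_kernel l N (n - int m) * u (int m))"
    by (simp add: L_kernel_def Re_e \<mu>_def sum_distrib_left sum_distrib_right sum_divide_distrib mult_ac)
  finally show ?thesis .
qed

lemma L_kernel_even: "L_kernel l N (- j) = L_kernel l N j"
  by (simp add: L_kernel_def)

lemma L_kernel_periodic: "L_kernel l N (j + int N) = L_kernel l N j"
proof (cases "N = 0")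
  case False
  have "cos (2 * pi * real_of_int (j + int N) * real k / real N)
      = cos (2 * pi * real_of_int j * real k / real N)" for k
  proof -
    have "2 * pi * real_of_int (j + int N) * real k / real N
        = 2 * pi * real_of_int j * real k / real N + 2 * real k * pi"
      using False by (simp add: field_simps)
    moreover have "cos (x + 2 * real k * pi) = cos x" for x :: real
      using cos_2npi[of k] sin_npi[of "2 * k"] by (simp add: cos_add)
    ultimately show ?thesis by (simp only:)
  qed
  then show ?thesis by (simp only: L_kernel_def)
qed simp

text \<open>Translation of the argument becomes a translation of the summation index, which the periodicity
  of kernel and argument allows.\<close>

lemma L_real_shift:
  assumes "\<And>m. u (m + int N) = u m"
  shows "L_real l N u (n + 1) = L_real l N (\<lambda>m. u (m + 1)) n"
proof -
  define f where "f m = L_kernel l N (n + 1 - m) * u m" for m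
  have "f (int N) = f 0"
    using assms[of 0] L_kernel_periodic[of l N "n + 1 - int N"] by (simp add: f_def)
  from sum_period_shift[OF this] show ?thesis
    by (simp add: L_real_convolution f_def)
qed

text \<open>The kernel is even, so the matrix with entries \<open>L_kernel l N (n - m)\<close> is symmetric.\<close>

lemma L_real_self_adjoint:
  "(\<Sum>n<N. a (int n) * L_real l N b (int n)) = (\<Sum>n<N. L_real l N a (int n) * b (int n))"
proof -
  have K: "L_kernel l N (int n - int m) = L_kernel l N (int m - int n)" for n m
    using L_kernel_even[of l N "int m - int n"] by simp
  have "(\<Sum>n<N. a (int n) * L_real l N b (int n))
      = (\<Sum>n<N. \<Sum>m<N. L_kernel l N (int n - int m) * a (int n) * b (int m))"
    by (simp add: L_real_convolution sum_distrib_left mult_ac)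
  also have "\<dots> = (\<Sum>m<N. \<Sum>n<N. L_kernel l N (int m - int n) * a (int n) * b (int m))"
    by (subst sum.swap) (simp add: K)
  also have "\<dots> = (\<Sum>n<N. L_real l N a (int n) * b (int n))"
    by (simp add: L_real_convolution sum_distrib_right)
  finally show ?thesis .
qed

lemma L_real_add:
  "L_real l N (\<lambda>m. u m + v m) n = L_real l N u n + L_real l N v n"
  by (simp add: L_real_convolution algebra_simps sum.distrib)

lemma L_real_cmult: "L_real l N (\<lambda>m. c * u m) n = c * L_real l N u n"
  by (simp add: L_real_convolution sum_distrib_left mult_ac)

text \<open>This exchange turns the term \<open>(L du)\<close> averaged at a cell midpoint, which is what the scheme
  produces, into \<open>L\<close> applied to the averaged \<open>du\<close>; only then are the two factors of the wedge
  product related by a self-adjoint operator.\<close>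

lemma L_form_midpoint:
  assumes "\<And>m. a (m + int N) = a m"
  shows "(1/2) *\<^sub>R (L_form l N a n + L_form l N a (n + 1))
       = L_form l N (\<lambda>m. (1/2) *\<^sub>R (a m + a (m + 1))) n"
proof (rule blinfun_eqI)
  fix \<xi>
  have "L_real l N (\<lambda>m. blinfun_apply (a m) \<xi>) (n + 1)
      = L_real l N (\<lambda>m. blinfun_apply (a (m + 1)) \<xi>) n"
    by (rule L_real_shift) (simp add: assms)
  then show "blinfun_apply ((1/2) *\<^sub>R (L_form l N a n + L_form l N a (n + 1))) \<xi>
      = blinfun_apply (L_form l N (\<lambda>m. (1/2) *\<^sub>R (a m + a (m + 1))) n) \<xi>"
    by (simp add: L_form_apply blinfun.bilinear_simps L_real_add L_real_cmult del: times_divide_eq_left)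
qed

text \<open>Evaluated on two tangent vectors, the sum is \<open>\<langle>f, L g\<rangle> - \<langle>L f, g\<rangle>\<close> for the real sequences \<open>f\<close>
  and \<open>g\<close> obtained from \<open>a\<close>, and \<open>L\<close> is self-adjoint.\<close>

lemma sum_wedge_L_form:
  "(\<Sum>n<N. wedge (a (int n)) (L_form l N a (int n))) = 0"
proof (intro blinfun_eqI)
  fix \<xi> \<eta>
  show "blinfun_apply (blinfun_apply (\<Sum>n<N. wedge (a (int n)) (L_form l N a (int n))) \<xi>) \<eta>
      = blinfun_apply (blinfun_apply 0 \<xi>) \<eta>"
    using L_real_self_adjoint[of "\<lambda>m. blinfun_apply (a m) \<xi>" l N "\<lambda>m. blinfun_apply (a m) \<eta>"]
    by (simp add: blinfun.bilinear_simps wedge_apply L_form_apply sum_subtractf)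
qed

section \<open>Skew-symmetric matrices and two-forms\<close>

lemma wedge_commute: "wedge a b = - wedge b a"
  by (simp add: wedge_def)

lemma wedge_self: "wedge a a = 0"
  by (simp add: wedge_def)

lemma wedge_add_right: "wedge a (b + c) = wedge a b + wedge a c"
  by (intro blinfun_eqI) (simp add: blinfun.bilinear_simps wedge_apply algebra_simps)

lemma wedge_diff_right: "wedge a (b - c) = wedge a b - wedge a c"
  by (intro blinfun_eqI) (simp add: blinfun.bilinear_simps wedge_apply algebra_simps)

lemma wedge_scaleR_right: "wedge a (r *\<^sub>R b) = r *\<^sub>R wedge a b"
  by (intro blinfun_eqI) (simp add: blinfun.bilinear_simps wedge_apply algebra_simps)

lemma wedge_minus_right: "wedge a (- b) = - wedge a b"
  by (intro blinfun_eqI) (simp add: blinfun.bilinear_simps wedge_apply algebra_simps)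

lemma wedge_zero_right: "wedge a 0 = 0"
  by (intro blinfun_eqI) (simp add: blinfun.bilinear_simps wedge_apply)

lemma wedge_vec_apply:
  "blinfun_apply (blinfun_apply (wedge_vec a b) \<xi>) \<eta>
     = (\<Sum>k\<in>UNIV. blinfun_apply (a $ k) \<xi> * blinfun_apply (b $ k) \<eta>
                    - blinfun_apply (b $ k) \<xi> * blinfun_apply (a $ k) \<eta>)"
  by (simp add: wedge_vec_def blinfun.sum_left wedge_apply)

lemma wedge_vec_add_left: "wedge_vec (a + b) c = wedge_vec a c + wedge_vec b c"
  by (intro blinfun_eqI)
     (simp add: blinfun.bilinear_simps wedge_vec_apply sum.distrib[symmetric] algebra_simps)

lemma wedge_vec_add_right: "wedge_vec a (b + c) = wedge_vec a b + wedge_vec a c"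
  by (intro blinfun_eqI)
     (simp add: blinfun.bilinear_simps wedge_vec_apply sum.distrib[symmetric] algebra_simps)

lemma wedge_vec_diff_right: "wedge_vec a (b - c) = wedge_vec a b - wedge_vec a c"
  by (intro blinfun_eqI)
     (simp add: blinfun.bilinear_simps wedge_vec_apply sum_subtractf[symmetric] algebra_simps)

lemma wedge_vec_scaleR_left: "wedge_vec (r *\<^sub>R a) b = r *\<^sub>R wedge_vec a b"
  by (intro blinfun_eqI)
     (simp add: blinfun.bilinear_simps wedge_vec_apply sum_distrib_left algebra_simps)

lemma wedge_vec_scaleR_right: "wedge_vec a (r *\<^sub>R b) = r *\<^sub>R wedge_vec a b"
  by (intro blinfun_eqI)
     (simp add: blinfun.bilinear_simps wedge_vec_apply sum_distrib_left algebra_simps)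

lemma matrix_form_mult_diff:
  "matrix_form_mult A (a - b) = matrix_form_mult A a - matrix_form_mult A b"
  by (simp add: matrix_form_mult_def vec_eq_iff scaleR_diff_right sum_subtractf)

lemma matrix_form_mult_scaleR:
  "matrix_form_mult A (r *\<^sub>R a) = r *\<^sub>R matrix_form_mult A a"
  by (simp add: matrix_form_mult_def vec_eq_iff scaleR_sum_right mult.commute)

text \<open>Moving \<open>A\<close> to the other factor costs one sign for the transpose, and exchanging the factors of
  the wedge product costs a second one.\<close>

lemma wedge_vec_skew_commute:
  assumes "transpose A = - A"
  shows "wedge_vec a (matrix_form_mult A b) = wedge_vec b (matrix_form_mult A a)"
proof -
  have skew: "A $ j $ k = - A $ k $ j" for j k
  proof -
    have "transpose A $ k $ j = (- A) $ k $ j" using assms by simp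
    then show ?thesis by (simp add: transpose_def)
  qed
  have expand: "wedge_vec c (matrix_form_mult A e) 
      = (\<Sum>j\<in>UNIV. \<Sum>k\<in>UNIV. (A $ j $ k) *\<^sub>R wedge (c $ j) (e $ k))" for c e :: "('a form1)^4"
    by (intro blinfun_eqI)
       (simp add: wedge_vec_apply matrix_form_mult_def blinfun.bilinear_simps blinfun.sum_left
          wedge_apply sum_distrib_left sum_distrib_right sum_subtractf[symmetric] algebra_simps)
  have "wedge_vec a (matrix_form_mult A b)
      = (\<Sum>k\<in>UNIV. \<Sum>j\<in>UNIV. (A $ j $ k) *\<^sub>R wedge (a $ j) (b $ k))"
    unfolding expand by (rule sum.swap)
  also have "\<dots> = (\<Sum>k\<in>UNIV. \<Sum>j\<in>UNIV. (A $ k $ j) *\<^sub>R wedge (b $ k) (a $ j))"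
  proof (intro sum.cong refl)
    fix j k
    show "(A $ j $ k) *\<^sub>R wedge (a $ j) (b $ k) = (A $ k $ j) *\<^sub>R wedge (b $ k) (a $ j)"
      by (subst wedge_commute, subst skew) simp
  qed
  finally show ?thesis unfolding expand .
qed

text \<open>The discrete product rule without remainder: expanding the right-hand side gives the left-hand
  side and the mixed terms \<open>a \<wedge> A b - b \<wedge> A a\<close>, which cancel by symmetry.\<close>

lemma skew_quadratic_difference:
  assumes "transpose A = - A"
  shows "(1/2) *\<^sub>R wedge_vec b (matrix_form_mult A b) - (1/2) *\<^sub>R wedge_vec a (matrix_form_mult A a)
       = wedge_vec ((1/2) *\<^sub>R (a + b)) (matrix_form_mult A (b - a))"
  using wedge_vec_skew_commute[OF assms, of a b]
  by (simp add: matrix_form_mult_diff wedge_vec_add_left wedge_vec_diff_right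
      wedge_vec_scaleR_left scaleR_add_right scaleR_diff_right)

lemma vector_4:
  "(vector [a, b, c, e] :: ('a::zero)^4) $ 1 = a"
  "(vector [a, b, c, e] :: ('a::zero)^4) $ 2 = b"
  "(vector [a, b, c, e] :: ('a::zero)^4) $ 3 = c"
  "(vector [a, b, c, e] :: ('a::zero)^4) $ 4 = e"
  unfolding vector_def by simp_all

lemma transpose_Mmat: "transpose Mmat = - Mmat"
  by (simp add: vec_eq_iff forall_4 transpose_def Mmat_def vector_4)

lemma transpose_Kmat: "transpose (Kmat \<beta>) = - Kmat \<beta>"
  by (simp add: vec_eq_iff forall_4 transpose_def Kmat_def vector_4)

lemma mean_t_mean_x_commute: "mean_t (mean_x f) = mean_x (mean_t f)"
  by (simp add: fun_eq_iff mean_t_def mean_x_def algebra_simps)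

lemma diff_t_\<omega>:
  "diff_t dt (\<omega> dz) i n
     = wedge_vec (mean_t (mean_x dz) i n) (matrix_form_mult Mmat (diff_t dt (mean_x dz) i n))"
  using skew_quadratic_difference[OF transpose_Mmat, of "mean_x dz (i + 1) n" "mean_x dz i n"]
  by (simp add: diff_t_def \<omega>_def mean_t_def[of "mean_x dz"] matrix_form_mult_scaleR
      wedge_vec_scaleR_right)

lemma diff_x_\<kappa>:
  "diff_x dx (\<kappa> \<beta> dz) i n
     = wedge_vec (mean_t (mean_x dz) i n) (matrix_form_mult (Kmat \<beta>) (diff_x dx (mean_t dz) i n))"
  using skew_quadratic_difference[OF transpose_Kmat[of \<beta>], of "mean_t dz i (n + 1)" "mean_t dz i n"]
  by (simp add: diff_x_def \<kappa>_def mean_t_mean_x_commute mean_x_def[of "mean_t dz"]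
      matrix_form_mult_scaleR wedge_vec_scaleR_right)

section \<open>The discrete variational equation\<close>

text \<open>Only here is the definition of the differentials by choice of a Frechet derivative opened up;
  all later differentiation goes through this fact.\<close>

lemma has_derivative_component_form:
  assumes "z i n differentiable (at p)"
  shows "((\<lambda>q. z i n q $ k) has_derivative blinfun_apply (d_grid z p i n $ k)) (at p)"
proof -
  from assms obtain z' where "(z i n has_derivative z') (at p)"
    unfolding differentiable_def by blast
  then have "((\<lambda>q. z i n q $ k) has_derivative (\<lambda>\<xi>. z' \<xi> $ k)) (at p)"
    by (rule bounded_linear.has_derivative[OF bounded_linear_vec_nth])
  then show ?thesis
    by (simp add: d_grid_def d_vec_def d_apply)
qed

text \<open>Two functions that agree on a neighbourhood of \<open>p\<close> have the same derivative at \<open>p\<close>.\<close>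

lemma d_grid_periodic:
  assumes "open U" "p \<in> U" and "\<And>q. q \<in> U \<Longrightarrow> z i (n + int N) q = z i n q"
    and "\<And>n. z i n differentiable (at p)"
  shows "d_grid z p i (n + int N) = d_grid z p i n"
proof -
  have "d_grid z p i (n + int N) $ k = d_grid z p i n $ k" for k
  proof -
    have "((\<lambda>q. z i n q $ k) has_derivative blinfun_apply (d_grid z p i (n + int N) $ k)) (at p)"
      by (rule has_derivative_transform_within_open[OF has_derivative_component_form assms(1,2)])
         (simp_all add: assms)
    from has_derivative_unique[OF this has_derivative_component_form[of z i n p k]]
    show ?thesis by (simp add: assms blinfun_apply_inject)
  qed
  then show ?thesis by (simp add: vec_eq_iff)
qed

text \<open>Both sides of the scheme, as functions of the parameter, agree on the open set \<open>U\<close>, so their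
  derivatives agree. The nonlinearity contributes the factor \<open>lam * uc\<close>, with \<open>uc\<close> the cell-centred
  value of \<open>u\<close>; the nonlocal term is differentiated as a finite convolution sum.\<close>

lemma variational_equation:
  fixes z :: "nat \<Rightarrow> int \<Rightarrow> 'p::real_normed_vector \<Rightarrow> real^4"
  assumes "open U" "p \<in> U"
    and smooth: "\<And>i n. z i n differentiable (at p)"
    and scheme: "\<And>q. q \<in> U \<Longrightarrow> box_scheme \<alpha> \<beta> \<gamma> lam l N dx dt (\<lambda>i n. z i n q)"
  defines "dz \<equiv> d_grid z p"
  shows "matrix_form_mult Mmat (diff_t dt (mean_x dz) i n)
       + matrix_form_mult (Kmat \<beta>) (diff_x dx (mean_t dz) i n)
     = (let a = mean_t (mean_x dz) i n;
            uc = mean_t (mean_x (\<lambda>i n. z i n p $ 1)) i n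
        in vector [- a $ 3 - (\<gamma> + lam * uc) *\<^sub>R a $ 1
                     + \<alpha> *\<^sub>R mean_x (\<lambda>i. L_form l N (mean_t (\<lambda>i n. dz i n $ 1) i)) i n,
                   0, - a $ 1, \<beta> *\<^sub>R a $ 4])"
    (is "?lhs = ?rhs")
proof -
  let ?F = "\<lambda>q. Mmat *v diff_t dt (mean_x (\<lambda>i n. z i n q)) i n
              + Kmat \<beta> *v diff_x dx (mean_t (\<lambda>i n. z i n q)) i n"
  let ?G = "\<lambda>q. grad_S \<alpha> \<beta> \<gamma> lam l N (\<lambda>i n. z i n q) i n"
  note D = has_derivative_component_form[of z _ _ p, OF smooth, folded dz_def]
  have dF: "((\<lambda>q. ?F q $ k) has_derivative blinfun_apply (?lhs $ k)) (at p)" for k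
    unfolding matrix_form_mult_def matrix_vector_mult_def mean_x_def mean_t_def diff_x_def diff_t_def
      vec_lambda_beta vector_add_component vector_minus_component vector_scaleR_component
      blinfun.add_left blinfun.sum_left blinfun.scaleR_left blinfun.diff_left real_scaleR_def
    by (intro has_derivative_add has_derivative_diff has_derivative_sum has_derivative_mult_right D)
  let ?c = "\<lambda>q. mean_t (mean_x (\<lambda>i n. z i n q)) i n"
  let ?L = "\<lambda>q. mean_x (\<lambda>i. L_real l N (mean_t (\<lambda>i n. z i n q $ 1) i)) i n"
  let ?dL = "mean_x (\<lambda>i. L_form l N (mean_t (\<lambda>i n. dz i n $ 1) i)) i n"
  have dc: "((\<lambda>q. ?c q $ k) has_derivative blinfun_apply (mean_t (mean_x dz) i n $ k)) (at p)" for k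
    unfolding mean_x_def mean_t_def vector_add_component vector_scaleR_component
      blinfun.add_left blinfun.scaleR_left real_scaleR_def
    by (intro has_derivative_add has_derivative_mult_right D)
  have dL: "(?L has_derivative blinfun_apply ?dL) (at p)"
    unfolding mean_x_def mean_t_def L_real_convolution L_form_apply
      blinfun.add_left blinfun.scaleR_left real_scaleR_def
    by (intro has_derivative_add has_derivative_sum has_derivative_mult_right D)
  have uc: "mean_t (mean_x (\<lambda>i n. z i n p $ 1)) i n = ?c p $ 1"
    by (simp add: mean_x_def mean_t_def)
  have dG: "((\<lambda>q. ?G q $ k) has_derivative blinfun_apply (?rhs $ k)) (at p)" for k
  proof -
    have "((\<lambda>q. - ?c q $ 3 - \<gamma> * ?c q $ 1 - lam / 2 * (?c q $ 1)\<^sup>2 + \<alpha> * ?L q) has_derivative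
        blinfun_apply (- mean_t (mean_x dz) i n $ 3
          - (\<gamma> + lam * ?c p $ 1) *\<^sub>R mean_t (mean_x dz) i n $ 1 + \<alpha> *\<^sub>R ?dL)) (at p)"
      by (rule has_derivative_eq_rhs, (rule derivative_intros dc dL)+)
         (simp add: fun_eq_iff blinfun.bilinear_simps algebra_simps)
    moreover have "((\<lambda>q. 0 :: real) has_derivative blinfun_apply 0) (at p)"
      by (simp add: zero_blinfun.rep_eq)
    moreover have "((\<lambda>q. - ?c q $ 1) has_derivative
        blinfun_apply (- mean_t (mean_x dz) i n $ 1)) (at p)"
      unfolding blinfun.minus_left by (intro has_derivative_minus dc)
    moreover have "((\<lambda>q. \<beta> * ?c q $ 4) has_derivative
        blinfun_apply (\<beta> *\<^sub>R mean_t (mean_x dz) i n $ 4)) (at p)"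
      unfolding blinfun.scaleR_left real_scaleR_def by (intro has_derivative_mult_right dc)
    ultimately have "\<forall>k. ((\<lambda>q. ?G q $ k) has_derivative blinfun_apply (?rhs $ k)) (at p)"
      unfolding forall_4 grad_S_def Let_def vector_4 uc by blast
    then show ?thesis ..
  qed
  have "?lhs $ k = ?rhs $ k" for k
  proof -
    have "((\<lambda>q. ?G q $ k) has_derivative blinfun_apply (?lhs $ k)) (at p)"
      by (rule has_derivative_transform_within_open[OF dF assms(1,2)])
         (use scheme in \<open>simp add: box_scheme_def\<close>)
    from has_derivative_unique[OF this dG] show ?thesis
      by (simp only: blinfun_apply_inject)
  qed
  then show ?thesis by (simp add: vec_eq_iff)
qed

section \<open>Multisymplectic and symplectic conservation\<close>

theorem theorem2:
  fixes \<alpha> \<beta> \<gamma> lam l dx dt :: real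
    and N :: nat
    and U :: "'p::real_normed_vector set"
    and z :: "nat \<Rightarrow> int \<Rightarrow> 'p \<Rightarrow> real^4"
  assumes "l > 0" and "N > 0" and "dx = l / real N" and "dt > 0"
    and "open U"
    and smooth: "\<And>i n p. p \<in> U \<Longrightarrow> z i n differentiable (at p)"
    and periodic: "\<And>i n p. p \<in> U \<Longrightarrow> z i (n + int N) p = z i n p"
    and scheme: "\<And>p. p \<in> U \<Longrightarrow> box_scheme \<alpha> \<beta> \<gamma> lam l N dx dt (\<lambda>i n. z i n p)"
  shows "\<forall>p\<in>U.
    (\<forall>i n.
       diff_t dt (\<omega> (d_grid z p)) i n + diff_x dx (\<kappa> \<beta> (d_grid z p)) i n
         = (let du = (\<lambda>i n. d_grid z p i n $ 1)
            in \<alpha> *\<^sub>R wedge (mean_t (mean_x du) i n)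
                            (mean_x (\<lambda>i. L_form l N (mean_t du i)) i n))) \<and>
    (\<forall>i.
       (1 / dt) *\<^sub>R ((\<Sum>n<N. \<omega> (d_grid z p) (i + 1) (int n))
                     - (\<Sum>n<N. \<omega> (d_grid z p) i (int n))) = 0)"
proof (intro ballI conjI allI)
  fix p assume p: "p \<in> U"
  define dz where "dz = d_grid z p"
  define du where "du = (\<lambda>i n. dz i n $ 1)"
  have dz_per: "dz i (n + int N) = dz i n" for i n
    unfolding dz_def using \<open>open U\<close> p periodic smooth[OF p] by (rule d_grid_periodic)
  have loc: "diff_t dt (\<omega> dz) i n + diff_x dx (\<kappa> \<beta> dz) i n
      = \<alpha> *\<^sub>R wedge (mean_t (mean_x du) i n) (mean_x (\<lambda>i. L_form l N (mean_t du i)) i n)" for i n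
  proof -
    define a where "a = mean_t (mean_x dz) i n"
    define b where "b = mean_x (\<lambda>i. L_form l N (mean_t du i)) i n"
    define c where "c = \<gamma> + lam * mean_t (mean_x (\<lambda>i n. z i n p $ 1)) i n"
    have a1: "mean_t (mean_x du) i n = a $ 1"
      by (simp add: a_def du_def mean_t_def mean_x_def)
    \<comment> \<open>Both matrix terms are wedged with the same \<open>a\<close>, so the variational equation applies.\<close>
    have "diff_t dt (\<omega> dz) i n + diff_x dx (\<kappa> \<beta> dz) i n
        = wedge_vec a (vector [- a $ 3 - c *\<^sub>R a $ 1 + \<alpha> *\<^sub>R b, 0, - a $ 1, \<beta> *\<^sub>R a $ 4])"
      using variational_equation[OF \<open>open U\<close> p smooth[OF p] scheme, of i n]
      by (simp add: diff_t_\<omega> diff_x_\<kappa> wedge_vec_add_right[symmetric] dz_def[symmetric]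
          a_def b_def c_def du_def Let_def)
    \<comment> \<open>\<open>a\<^sub>1 \<wedge> a\<^sub>3\<close> and \<open>a\<^sub>3 \<wedge> a\<^sub>1\<close> cancel; the terms in \<open>a\<^sub>1 \<wedge> a\<^sub>1\<close> and \<open>a\<^sub>4 \<wedge> a\<^sub>4\<close> vanish.\<close>
    also have "\<dots> = \<alpha> *\<^sub>R wedge (a $ 1) b"
      using wedge_commute[of "a $ 1" "a $ 3"]
      by (simp add: wedge_vec_def sum_4 wedge_add_right wedge_minus_right wedge_scaleR_right
          wedge_diff_right wedge_self wedge_zero_right vector_4)
    finally show ?thesis by (simp add: a1 b_def)
  qed
  show "diff_t dt (\<omega> (d_grid z p)) i n + diff_x dx (\<kappa> \<beta> (d_grid z p)) i n
      = (let du = (\<lambda>i n. d_grid z p i n $ 1)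
         in \<alpha> *\<^sub>R wedge (mean_t (mean_x du) i n)
                         (mean_x (\<lambda>i. L_form l N (mean_t du i)) i n))" for i n
    using loc[of i n] unfolding Let_def dz_def du_def .
  show "(1 / dt) *\<^sub>R ((\<Sum>n<N. \<omega> (d_grid z p) (i + 1) (int n))
                     - (\<Sum>n<N. \<omega> (d_grid z p) i (int n))) = 0" for i
  proof -
    define A where "A = (\<lambda>n. mean_x (mean_t du) i n)"
    have du_per: "mean_t du i (n + int N) = mean_t du i n" for n
      by (simp add: mean_t_def du_def dz_per)
    have L: "mean_x (\<lambda>i. L_form l N (mean_t du i)) i n = L_form l N A n" for n
      using L_form_midpoint[of "mean_t du i" N l n, OF du_per] by (simp add: mean_x_def A_def)
    have "\<kappa> \<beta> dz i (int N) = \<kappa> \<beta> dz i 0"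
      using dz_per[of i 0] dz_per[of "i + 1" 0] by (simp add: \<kappa>_def mean_t_def)
    from sum_period_shift[of "\<lambda>n. \<kappa> \<beta> dz i n", OF this]
    have \<kappa>_tel: "(\<Sum>n<N. diff_x dx (\<kappa> \<beta> dz) i (int n)) = 0"
      by (simp add: diff_x_def scaleR_sum_right[symmetric] sum_subtractf)
    \<comment> \<open>The flux differences sum to zero, so adding them makes the local law applicable.\<close>
    have "(1 / dt) *\<^sub>R ((\<Sum>n<N. \<omega> dz (i + 1) (int n)) - (\<Sum>n<N. \<omega> dz i (int n)))
        = (\<Sum>n<N. diff_t dt (\<omega> dz) i (int n)) + (\<Sum>n<N. diff_x dx (\<kappa> \<beta> dz) i (int n))"
      unfolding \<kappa>_tel by (simp add: diff_t_def scaleR_sum_right[symmetric] sum_subtractf)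
    also have "\<dots> = \<alpha> *\<^sub>R (\<Sum>n<N. wedge (A (int n)) (L_form l N A (int n)))"
      by (simp add: sum.distrib[symmetric] loc L scaleR_sum_right mean_t_mean_x_commute A_def)
    also have "\<dots> = 0"
      by (simp only: sum_wedge_L_form scaleR_zero_right)
    finally show ?thesis by (simp add: dz_def)
  qed
qed

end
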